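(* Let $\mathbb{F}$ be any field, let $G=([n],E)$ be a directed graph and $\mathcal{S}_G=\langle\mathrm{E}_{i,j}\mid (i,j)\in E\rangle\le\mathrm{M}(n,\mathbb{F})$. Then $c(G)=c(\mathcal{S}_G)$. In particular, $G$ is strongly connected if and only if $\mathcal{S}_G$ is irreducible.
   Context: Directed graph: $E\subseteq[n]\times[n]$. $G$ is strongly connected if there is a directed path between every ordered pair of vertices; $c(G)$ is the number of strongly connected components of $G$. Vectors in $\mathbb{F}^n$ are row vectors and matrices act on the right: for $B\in\mathrm{M}(n,\mathbb{F})$ and $U\le\mathbb{F}^n$, $B(U)=\{uB\mid u\in U\}$. For $\mathcal{S}\le\mathrm{M}(n,\mathbb{F})$, a subspace $U\le\mathbb{F}^n$ is invariant if $B(U)\le U$ for all $B\in\mathcal{S}$; $\mathcal{S}$ is irreducible if its only invariant subspaces are $0$ and $\mathbb{F}^n$. $c(\mathcal{S})$ is the length $k$ of a maximal chain $0=U_0<U_1<\dots<U_k=\mathbb{F}^n$ of invariant subspaces (maximal meaning the induced action of $\mathcal{S}$ on each $U_i/U_{i-1}$ is irreducible; all such chains have the same length). $\mathrm{E}_{i,j}$ is the elementary matrix with $1$ at $(i,j)$. *)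

theory Defs
  imports "HOL-Analysis.Analysis" "Graph_Theory.Graph_Theory"
begin

text \<open>The index set $[n]$, $n \ge 1$, is the universe of a finite type \<open>'n\<close>; a digraph on $[n]$ is given
  by its arc relation, so loops are allowed and parallel arcs are not.\<close>

definition digraph_of :: "('n \<times> 'n) set \<Rightarrow> ('n, 'n \<times> 'n) pre_digraph" where
  "digraph_of E = with_proj \<lparr>pverts = UNIV, parcs = E\<rparr>"

definition num_sccs :: "('a, 'b) pre_digraph \<Rightarrow> nat" where
  "num_sccs G = card (pre_digraph.sccs G)"


definition matrix_scale :: "'a::field \<Rightarrow> 'a^'m^'n \<Rightarrow> 'a^'m^'n" where
  "matrix_scale c = map_matrix ((*) c)"

interpretation matrix: vector_space matrix_scale
  by unfold_locales (simp_all add: matrix_scale_def vec_eq_iff algebra_simps)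

definition elementary_matrix :: "'n \<Rightarrow> 'n \<Rightarrow> 'a::field^'n^'n" where
  "elementary_matrix i j = (\<chi> a b. if a = i \<and> b = j then 1 else 0)"

definition graph_matrix_space :: "('n \<times> 'n) set \<Rightarrow> ('a::field^'n^'n) set" where
  "graph_matrix_space E = matrix.span {elementary_matrix i j | i j. (i, j) \<in> E}"


text \<open>Vectors are row vectors and matrices act on the right.\<close>

definition invariant_subspace :: "('a::field^'n^'n) set \<Rightarrow> ('a^'n) set \<Rightarrow> bool" where
  "invariant_subspace S U \<longleftrightarrow> vec.subspace U \<and> (\<forall>B\<in>S. (\<lambda>u. u v* B) ` U \<subseteq> U)"

definition irreducible_matrix_space :: "('a::field^'n^'n) set \<Rightarrow> bool" where
  "irreducible_matrix_space S \<longleftrightarrow> (\<forall>U. invariant_subspace S U \<longrightarrow> U = {0} \<or> U = UNIV)"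

text \<open>The quotient $U/W$ is the set of cosets \<open>vec_coset W ` U\<close>. Addition, scaling and the induced action
  are given on representatives, which is well defined if \<open>W\<close> and \<open>U\<close> are invariant subspaces
  with \<open>W \<subseteq> U\<close>.\<close>

definition vec_coset :: "('a::field^'n) set \<Rightarrow> 'a^'n \<Rightarrow> ('a^'n) set" where
  "vec_coset W u = {u + w | w. w \<in> W}"

definition quotient_invariant_subspace ::
    "('a::field^'n^'n) set \<Rightarrow> ('a^'n) set \<Rightarrow> ('a^'n) set \<Rightarrow> ('a^'n) set set \<Rightarrow> bool" where
  "quotient_invariant_subspace S U W Q \<longleftrightarrow>
     Q \<subseteq> vec_coset W ` U \<and>
     vec_coset W 0 \<in> Q \<and>
     (\<forall>u\<in>U. \<forall>v\<in>U. vec_coset W u \<in> Q \<longrightarrow> vec_coset W v \<in> Q \<longrightarrow> vec_coset W (u + v) \<in> Q) \<and>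
     (\<forall>c. \<forall>u\<in>U. vec_coset W u \<in> Q \<longrightarrow> vec_coset W (c *s u) \<in> Q) \<and>
     (\<forall>B\<in>S. \<forall>u\<in>U. vec_coset W u \<in> Q \<longrightarrow> vec_coset W (u v* B) \<in> Q)"

definition irreducible_on_quotient ::
    "('a::field^'n^'n) set \<Rightarrow> ('a^'n) set \<Rightarrow> ('a^'n) set \<Rightarrow> bool" where
  "irreducible_on_quotient S U W \<longleftrightarrow>
     (\<forall>Q. quotient_invariant_subspace S U W Q \<longrightarrow> Q = {vec_coset W 0} \<or> Q = vec_coset W ` U)"

definition maximal_invariant_chain ::
    "('a::field^'n^'n) set \<Rightarrow> nat \<Rightarrow> (nat \<Rightarrow> ('a^'n) set) \<Rightarrow> bool" where
  "maximal_invariant_chain S k U \<longleftrightarrow>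
     U 0 = {0} \<and> U k = UNIV \<and>
     (\<forall>i\<le>k. invariant_subspace S (U i)) \<and>
     (\<forall>i<k. U i \<subset> U (Suc i) \<and> irreducible_on_quotient S (U (Suc i)) (U i))"

text \<open>All maximal chains have the same length, by the Jordan-Hoelder theorem.\<close>

definition chain_length :: "('a::field^'n^'n) set \<Rightarrow> nat" where
  "chain_length S = (THE k. \<exists>U. maximal_invariant_chain S k U)"

end

theory Submission
  imports Defs
begin

text \<open>Choose a set \<open>T\<close> of representatives of the strongly connected components and measure an
  invariant subspace \<open>U\<close> by the dimension of \<open>U \<inter> coord_space T\<close>. This measure is \<open>0\<close> on \<open>{0}\<close> and
  \<open>card T\<close> on the whole space, and it goes up by exactly \<open>1\<close> from \<open>W\<close> to \<open>U\<close> whenever \<open>U/W\<close> is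
  irreducible; so every maximal chain has length \<open>card T\<close>. The reason is that a vertex \<open>v\<close> which is
  not a representative lies on a cycle, so \<open>u $ v \<noteq> 0\<close> for some \<open>u \<in> U\<close> already forces \<open>U\<close> to
  contain the coordinate vectors of the whole component of \<open>v\<close>; and an irreducible step that
  adds a coordinate vector at all adds those of a single component.\<close>

section \<open>Strongly connected components and their representatives\<close>

definition scc_class :: "('n \<times> 'n) set \<Rightarrow> 'n \<Rightarrow> 'n set" where
  "scc_class E v = {w. (v, w) \<in> E\<^sup>* \<and> (w, v) \<in> E\<^sup>*}"

text \<open>The choice is made from the class as a set, so vertices with equal classes automatically
  receive the same representative.\<close>

definition scc_rep :: "('n \<times> 'n) set \<Rightarrow> 'n \<Rightarrow> 'n" where
  "scc_rep E v = (SOME w. w \<in> scc_class E v)"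

lemma scc_class_eq: "w \<in> scc_class E v \<Longrightarrow> scc_class E w = scc_class E v"
  unfolding scc_class_def by (auto intro: rtrancl_trans)

lemma scc_rep_in_class: "scc_rep E v \<in> scc_class E v"
  unfolding scc_rep_def by (rule someI[of _ v]) (simp add: scc_class_def)

lemma scc_rep_eq: "w \<in> scc_class E v \<Longrightarrow> scc_rep E w = scc_rep E v"
  unfolding scc_rep_def by (simp add: scc_class_eq)

lemma scc_rep_reaches: "(scc_rep E v, v) \<in> E\<^sup>*" "(v, scc_rep E v) \<in> E\<^sup>*"
  using scc_rep_in_class[of E v] by (auto simp: scc_class_def)

lemma scc_rep_idem: "scc_rep E (scc_rep E v) = scc_rep E v"
  by (rule scc_rep_eq[OF scc_rep_in_class])

text \<open>The path from \<open>v\<close> to its representative has at least one edge because its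
  ends differ, and the representative leads back to \<open>v\<close>. Thus a vertex on no cycle
  always represents itself.\<close>

lemma on_cycle_if_not_rep:
  assumes "v \<notin> range (scc_rep E)"
  shows "(v, v) \<in> E\<^sup>+"
proof -
  have "scc_rep E v \<noteq> v" using assms by (metis rangeI)
  then have "(v, scc_rep E v) \<in> E\<^sup>+" using scc_rep_reaches(2)[of v E] by (metis rtranclD)
  then show ?thesis using scc_rep_reaches(1)[of E v] by (rule trancl_rtrancl_trancl)
qed

lemma wf_digraph_of: "wf_digraph (digraph_of E)"
  by unfold_locales (auto simp: digraph_of_def)

lemma reachable_digraph_of: "reachable (digraph_of E) u v \<longleftrightarrow> (u, v) \<in> E\<^sup>*"
proof -
  interpret wf_digraph "digraph_of E" by (rule wf_digraph_of)
  have "arcs_ends (digraph_of E) = E" by (auto simp: digraph_of_def arcs_ends_conv)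
  then show ?thesis using reachable_conv[of u v] by (simp add: digraph_of_def)
qed

text \<open>Components are counted through their vertex sets, which are the classes;
  \<open>scc_class E\<close> is injective on representatives because the class determines the
  choice.\<close>

lemma num_sccs_digraph_of: "num_sccs (digraph_of E) = card (range (scc_rep E))"
proof -
  interpret wf_digraph "digraph_of E" by (rule wf_digraph_of)
  have "scc_of = scc_class E"
    by (simp add: scc_of_def scc_class_def reachable_digraph_of fun_eq_iff)
  then have "sccs_verts = range (scc_class E)"
    using sccs_verts_conv_scc_of by (simp add: digraph_of_def)
  also have "\<dots> = scc_class E ` range (scc_rep E)"
    by (simp add: image_image scc_class_eq[OF scc_rep_in_class])
  finally have "num_sccs (digraph_of E) = card (scc_class E ` range (scc_rep E))"
    by (simp add: num_sccs_def flip: card_sccs_verts)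
  moreover have "inj_on (scc_class E) (range (scc_rep E))"
    by (intro inj_onI) (metis scc_rep_def scc_rep_idem rangeE)
  ultimately show ?thesis by (simp add: card_image)
qed

lemma strongly_connected_digraph_of:
  "strongly_connected (digraph_of E) \<longleftrightarrow> (\<forall>u v. (u, v) \<in> E\<^sup>*)"
  unfolding strongly_connected_def reachable_digraph_of by (simp add: digraph_of_def)

section \<open>Coordinate subspaces and projections\<close>

definition coord_space :: "'n set \<Rightarrow> ('a::field^'n) set" where
  "coord_space T = {x. \<forall>i. i \<notin> T \<longrightarrow> x $ i = 0}"

text \<open>This is the linear projection onto \<open>coord_space T\<close>. For \<open>T\<close>
  the set of representatives it maps every invariant subspace into itself, which makes it useful for
  bounding the measure.\<close>

definition restrict_coords :: "'n set \<Rightarrow> 'a::field^'n \<Rightarrow> 'a^'n" where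
  "restrict_coords T x = (\<chi> i. if i \<in> T then x $ i else 0)"

lemma restrict_coords_add: "restrict_coords T (x + y) = restrict_coords T x + restrict_coords T y"
  by (simp add: restrict_coords_def vec_eq_iff)

lemma restrict_coords_scale: "restrict_coords T (c *s x) = c *s restrict_coords T x"
  by (simp add: restrict_coords_def vec_eq_iff)

lemma restrict_coords_id: "x \<in> coord_space T \<Longrightarrow> restrict_coords T x = x"
  by (simp add: restrict_coords_def coord_space_def vec_eq_iff)

lemma axis_zero: "axis j 0 = 0"
  by (simp add: axis_def vec_eq_iff)

lemma scale_axis: "c *s axis j (1 :: 'a::field) = axis j c"
  by (simp add: vec_eq_iff axis_def)

lemma axis_in_coord_space: "axis j (1 :: 'a::field) \<in> coord_space T \<longleftrightarrow> j \<in> T"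
  by (simp add: coord_space_def axis_def)

lemma subspace_coord_space: "vec.subspace (coord_space T)"
  by (auto simp: vec.subspace_def coord_space_def)

lemma dim_coord_space: "vec.dim (coord_space T :: ('a::field^'n) set) = card T"
  unfolding coord_space_def by (rule dim_substandard_cart)

lemma dim_less_if_psubset:
  fixes A B :: "('a::field^'n::finite) set"
  assumes "vec.subspace A" "vec.subspace B" "A \<subset> B"
  shows "vec.dim A < vec.dim B"
proof (rule vec.dim_psubset)
  show "vec.span A \<subset> vec.span B"
    unfolding vec.span_eq_iff[THEN iffD2, OF assms(1)] vec.span_eq_iff[THEN iffD2, OF assms(2)]
    by (rule assms(3))
qed

lemma coord_space_subset:
  assumes "vec.subspace U" "\<And>i. i \<in> T \<Longrightarrow> axis i 1 \<in> U"
  shows "coord_space T \<subseteq> (U :: ('a::field^'n) set)"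
proof
  fix x :: "'a^'n" assume x: "x \<in> coord_space T"
  have "x = (\<Sum>i\<in>UNIV. x $ i *s axis i 1)" by (simp add: basis_expansion)
  also have "\<dots> \<in> U"
  proof (rule vec.subspace_sum[OF assms(1)])
    fix i show "x $ i *s axis i 1 \<in> U"
      using x assms by (cases "i \<in> T") (auto simp: coord_space_def vec.subspace_scale vec.subspace_0)
  qed
  finally show "x \<in> U" .
qed

section \<open>Invariant subspaces of \<open>graph_matrix_space E\<close>\<close>

lemma vector_mult_elementary_matrix:
  "(u :: 'a::field^'n) v* elementary_matrix i j = axis j (u $ i)"
  by (auto simp: vec_eq_iff vector_matrix_mult_def elementary_matrix_def axis_def
      if_distrib[of "(*) _"] if_distrib[of "\<lambda>x. x * _"] cong: if_cong)

text \<open>The matrices mapping a fixed subspace \<open>U\<close> into itself form a linear space,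
  so invariance need only be tested on the spanning elementary matrices.\<close>

lemma invariant_subspace_graph_iff:
  fixes U :: "('a::field^'n) set"
  shows "invariant_subspace (graph_matrix_space E) U \<longleftrightarrow>
    vec.subspace U \<and> (\<forall>(i, j)\<in>E. \<forall>u\<in>U. axis j (u $ i) \<in> U)"
proof
  assume inv: "invariant_subspace (graph_matrix_space E) U"
  have "axis j (u $ i) \<in> U" if "(i, j) \<in> E" "u \<in> U" for i j u
  proof -
    have "elementary_matrix i j \<in> (graph_matrix_space E :: ('a^'n^'n) set)"
      unfolding graph_matrix_space_def using that by (auto intro: matrix.span_base)
    then have "u v* elementary_matrix i j \<in> U"
      using inv that unfolding invariant_subspace_def by blast
    then show ?thesis by (simp only: vector_mult_elementary_matrix)
  qed
  then show "vec.subspace U \<and> (\<forall>(i, j)\<in>E. \<forall>u\<in>U. axis j (u $ i) \<in> U)"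
    using inv by (auto simp: invariant_subspace_def)
next
  assume R: "vec.subspace U \<and> (\<forall>(i, j)\<in>E. \<forall>u\<in>U. axis j (u $ i) \<in> U)"
  have "matrix.subspace {B :: 'a^'n^'n. \<forall>u\<in>U. u v* B \<in> U}"
  proof (rule matrix.subspaceI)
    show "0 \<in> {B :: 'a^'n^'n. \<forall>u\<in>U. u v* B \<in> U}"
      using R by (simp add: vec.subspace_0)
  next
    fix A B :: "'a^'n^'n"
    assume "A \<in> {B. \<forall>u\<in>U. u v* B \<in> U}" "B \<in> {B. \<forall>u\<in>U. u v* B \<in> U}"
    then show "A + B \<in> {B. \<forall>u\<in>U. u v* B \<in> U}"
      using R by (simp add: vector_matrix_mult_add_rdistrib vec.subspace_add)
  next
    fix c and B :: "'a^'n^'n"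
    assume B: "B \<in> {B. \<forall>u\<in>U. u v* B \<in> U}"
    have "u v* matrix_scale c B = c *s (u v* B)" for u
      by (simp add: vec_eq_iff vector_matrix_mult_def matrix_scale_def map_matrix_def
          sum_distrib_left mult_ac)
    then show "matrix_scale c B \<in> {B. \<forall>u\<in>U. u v* B \<in> U}"
      using R B by (simp add: vec.subspace_scale)
  qed
  moreover have "{elementary_matrix i j |i j. (i, j) \<in> E} \<subseteq> {B :: 'a^'n^'n. \<forall>u\<in>U. u v* B \<in> U}"
    using R by (auto simp: vector_mult_elementary_matrix)
  ultimately have "graph_matrix_space E \<subseteq> {B :: 'a^'n^'n. \<forall>u\<in>U. u v* B \<in> U}"
    unfolding graph_matrix_space_def by (intro matrix.span_minimal)
  then show "invariant_subspace (graph_matrix_space E) U"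
    using R by (auto simp: invariant_subspace_def)
qed

lemma invariant_subspaceD: "invariant_subspace S U \<Longrightarrow> vec.subspace U"
  by (simp add: invariant_subspace_def)

lemma invariant_axis:
  assumes "invariant_subspace (graph_matrix_space E) U" "(i, j) \<in> E" "u \<in> U"
  shows "axis j (u $ i) \<in> U"
  using assms unfolding invariant_subspace_graph_iff by blast

lemma invariant_edge:
  fixes U :: "('a::field^'n) set"
  assumes inv: "invariant_subspace (graph_matrix_space E) U"
    and "u \<in> U" "u $ i \<noteq> 0" "(i, j) \<in> E"
  shows "axis j 1 \<in> U"
proof -
  have "axis j (u $ i) \<in> U" by (rule invariant_axis[OF inv assms(4,2)])
  then have "inverse (u $ i) *s axis j (u $ i) \<in> U"
    by (intro vec.subspace_scale[OF invariant_subspaceD[OF inv]])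
  also have "inverse (u $ i) *s axis j (u $ i) = axis j 1"
    using assms(3) by (simp add: vec_eq_iff axis_def)
  finally show ?thesis .
qed

text \<open>The first edge isolates the coordinate \<open>u $ i\<close> and yields a genuine
  coordinate vector, which then travels along the remaining edges. With the empty path nothing would
  be isolated, hence \<open>E\<^sup>+\<close>.\<close>

lemma invariant_trancl:
  fixes U :: "('a::field^'n) set"
  assumes inv: "invariant_subspace (graph_matrix_space E) U"
    and "u \<in> U" "u $ i \<noteq> 0" "(i, j) \<in> E\<^sup>+"
  shows "axis j 1 \<in> U"
  using assms(4)
proof (induction rule: trancl_induct)
  case (base k)
  then show ?case using invariant_edge assms by blast
next
  case (step k l)
  show ?case by (rule invariant_edge[OF inv step.IH _ step.hyps(2)]) simp
qed

lemma invariant_rtrancl: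
  fixes U :: "('a::field^'n) set"
  assumes inv: "invariant_subspace (graph_matrix_space E) U"
    and "axis i 1 \<in> U" "(i, j) \<in> E\<^sup>*"
  shows "axis j 1 \<in> U"
proof (cases "i = j")
  case False
  then have "(i, j) \<in> E\<^sup>+" using assms(3) by (simp add: rtrancl_eq_or_trancl)
  then show ?thesis by (rule invariant_trancl[OF inv assms(2), rotated]) simp
qed (use assms(2) in simp)

lemma invariant_non_rep:
  fixes U :: "('a::field^'n) set"
  assumes inv: "invariant_subspace (graph_matrix_space E) U"
    and "u \<in> U" "u $ v \<noteq> 0" "v \<notin> range (scc_rep E)"
  shows "axis v 1 \<in> U"
  by (rule invariant_trancl[OF inv assms(2,3) on_cycle_if_not_rep[OF assms(4)]])

text \<open>The part of \<open>u\<close> that the projection removes is supported on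
  non-representatives \<open>v\<close> with \<open>u $ v \<noteq> 0\<close>. Their coordinate
  vectors all lie in \<open>U\<close>, so the removed part does too.\<close>

lemma restrict_coords_rep_in:
  fixes U :: "('a::field^'n) set"
  assumes inv: "invariant_subspace (graph_matrix_space E) U" and u: "u \<in> U"
  shows "restrict_coords (range (scc_rep E)) u \<in> U \<inter> coord_space (range (scc_rep E))"
proof -
  let ?T = "range (scc_rep E)"
  note sub = invariant_subspaceD[OF inv]
  have "u - restrict_coords ?T u \<in> coord_space {v. u $ v \<noteq> 0 \<and> v \<notin> ?T}"
    by (auto simp: coord_space_def restrict_coords_def)
  also have "coord_space {v. u $ v \<noteq> 0 \<and> v \<notin> ?T} \<subseteq> U"
    using invariant_non_rep[OF inv u] by (intro coord_space_subset[OF sub]) auto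
  finally have "u - (u - restrict_coords ?T u) \<in> U"
    by (rule vec.subspace_diff[OF sub u])
  then have "restrict_coords ?T u \<in> U" by (simp only: diff_diff_eq2 add_diff_cancel_left')
  then show ?thesis by (simp add: coord_space_def restrict_coords_def)
qed

text \<open>If the two intersections agreed, any \<open>u\<close> in \<open>U\<close> would lie in
  \<open>W\<close>. Its projection to the representatives does by assumption. Each other coordinate
  \<open>v\<close> in its support has its coordinate vector in \<open>U\<close>; following a path to
  the representative of \<open>v\<close>, crossing over to \<open>W\<close> there, and returning to
  \<open>v\<close> puts that vector in \<open>W\<close>.\<close>

lemma invariant_measure_strict_mono:
  fixes W U :: "('a::field^'n::finite) set"
  assumes W: "invariant_subspace (graph_matrix_space E) W"
    and U: "invariant_subspace (graph_matrix_space E) U" and "W \<subset> U"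
  shows "vec.dim (W \<inter> coord_space (range (scc_rep E))) < vec.dim (U \<inter> coord_space (range (scc_rep E)))"
proof -
  let ?T = "range (scc_rep E)"
  note subW = invariant_subspaceD[OF W] and subU = invariant_subspaceD[OF U]
  have "W \<inter> coord_space ?T \<noteq> U \<inter> coord_space ?T"
  proof
    assume eq: "W \<inter> coord_space ?T = U \<inter> coord_space ?T"
    obtain u where u: "u \<in> U" "u \<notin> W" using \<open>W \<subset> U\<close> by blast
    have Pu: "restrict_coords ?T u \<in> W" using restrict_coords_rep_in[OF U u(1)] eq by blast
    have "axis v 1 \<in> W" if "v \<notin> ?T" "u $ v \<noteq> 0" for v
    proof -
      have "axis v 1 \<in> U" by (rule invariant_non_rep[OF U u(1) that(2,1)])
      then have "axis (scc_rep E v) 1 \<in> U"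
        by (rule invariant_rtrancl[OF U _ scc_rep_reaches(2)])
      moreover have "axis (scc_rep E v) 1 \<in> coord_space ?T"
        by (simp add: axis_in_coord_space)
      ultimately have "axis (scc_rep E v) 1 \<in> W" using eq by blast
      then show ?thesis by (rule invariant_rtrancl[OF W _ scc_rep_reaches(1)])
    qed
    then have "coord_space {v. v \<notin> ?T \<and> u $ v \<noteq> 0} \<subseteq> W"
      by (intro coord_space_subset[OF subW]) auto
    moreover have "u - restrict_coords ?T u \<in> coord_space {v. v \<notin> ?T \<and> u $ v \<noteq> 0}"
      by (auto simp: coord_space_def restrict_coords_def)
    ultimately have "(u - restrict_coords ?T u) + restrict_coords ?T u \<in> W"
      using Pu by (intro vec.subspace_add[OF subW]) auto
    then show False using u(2) by simp
  qed
  then have "W \<inter> coord_space ?T \<subset> U \<inter> coord_space ?T" using \<open>W \<subset> U\<close> by blast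
  then show ?thesis
    by (intro dim_less_if_psubset vec.subspace_inter subW subU subspace_coord_space)
qed

section \<open>Irreducible quotients as covering pairs of invariant subspaces\<close>

definition covers :: "('a::field^'n^'n) set \<Rightarrow> ('a^'n) set \<Rightarrow> ('a^'n) set \<Rightarrow> bool" where
  "covers S U W \<longleftrightarrow> W \<subset> U \<and> (\<forall>X. invariant_subspace S X \<longrightarrow> W \<subseteq> X \<longrightarrow> X \<subseteq> U \<longrightarrow> X = W \<or> X = U)"

lemma vec_coset_eq_iff:
  assumes "vec.subspace W"
  shows "vec_coset W u = vec_coset W v \<longleftrightarrow> u - v \<in> W"
proof
  assume "vec_coset W u = vec_coset W v"
  moreover have "u \<in> vec_coset W u"
    using vec.subspace_0[OF assms] by (force simp: vec_coset_def)
  ultimately show "u - v \<in> W" by (auto simp: vec_coset_def)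
next
  assume uv: "u - v \<in> W"
  have "\<exists>w'\<in>W. u + w = v + w'" if "w \<in> W" for w
    using vec.subspace_add[OF assms uv that] by (intro bexI[of _ "u - v + w"]) auto
  moreover have "\<exists>w'\<in>W. v + w = u + w'" if "w \<in> W" for w
    using vec.subspace_diff[OF assms that uv] by (intro bexI[of _ "w - (u - v)"]) auto
  ultimately show "vec_coset W u = vec_coset W v" unfolding vec_coset_def by blast
qed

text \<open>This is the correspondence theorem: taking images and preimages under the quotient map
  matches invariant subspaces between \<open>W\<close> and \<open>U\<close> with invariant subspaces
  of the quotient.\<close>

lemma irreducible_on_quotient_iff_covers:
  assumes W: "invariant_subspace S W" and U: "invariant_subspace S U" and WU: "W \<subset> U"
  shows "irreducible_on_quotient S U W \<longleftrightarrow> covers S U W"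
proof
  note subW = invariant_subspaceD[OF W] and subU = invariant_subspaceD[OF U]
  assume irr: "irreducible_on_quotient S U W"
  have "X = W \<or> X = U" if X: "invariant_subspace S X" and WX: "W \<subseteq> X" and XU: "X \<subseteq> U" for X
  proof -
    note subX = invariant_subspaceD[OF X]
    \<comment> \<open>Since \<open>X\<close> contains \<open>W\<close>, it is a union of cosets.
      This equivalence turns every closure condition on the image in the quotient into the same
      condition on \<open>X\<close>.\<close>
    have mem: "vec_coset W u \<in> vec_coset W ` X \<longleftrightarrow> u \<in> X" for u
    proof
      assume "vec_coset W u \<in> vec_coset W ` X"
      then obtain x where x: "x \<in> X" "vec_coset W u = vec_coset W x" by blast
      then have "u - x \<in> X" using WX by (auto simp only: vec_coset_eq_iff[OF subW])
      then have "(u - x) + x \<in> X" by (rule vec.subspace_add[OF subX _ x(1)])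
      then show "u \<in> X" by simp
    qed auto
    have "quotient_invariant_subspace S U W (vec_coset W ` X)"
      unfolding quotient_invariant_subspace_def mem
    proof (intro conjI ballI allI impI)
      show "vec_coset W ` X \<subseteq> vec_coset W ` U" using XU by (rule image_mono)
      show "0 \<in> X" by (rule vec.subspace_0[OF subX])
      show "u + v \<in> X" if "u \<in> X" "v \<in> X" for u v by (rule vec.subspace_add[OF subX that])
      show "c *s u \<in> X" if "u \<in> X" for c u by (rule vec.subspace_scale[OF subX that])
      show "u v* B \<in> X" if "B \<in> S" "u \<in> X" for B u
        using X that unfolding invariant_subspace_def by blast
    qed
    then consider "vec_coset W ` X = {vec_coset W 0}" | "vec_coset W ` X = vec_coset W ` U"
      using irr unfolding irreducible_on_quotient_def by blast
    then show ?thesis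
    proof cases
      case 1
      have "x \<in> W" if "x \<in> X" for x
      proof -
        have "vec_coset W x = vec_coset W 0" using 1 that by blast
        then show ?thesis by (simp add: vec_coset_eq_iff[OF subW])
      qed
      then show ?thesis using WX by blast
    next
      case 2
      then have "U \<subseteq> X" using mem by blast
      then show ?thesis using XU by simp
    qed
  qed
  then show "covers S U W" using WU by (auto simp: covers_def)
next
  note subW = invariant_subspaceD[OF W] and subU = invariant_subspaceD[OF U]
  assume cov: "covers S U W"
  show "irreducible_on_quotient S U W"
    unfolding irreducible_on_quotient_def
  proof (intro allI impI)
    fix Q assume Q: "quotient_invariant_subspace S U W Q"
    \<comment> \<open>The preimage of \<open>Q\<close> under the quotient map.\<close>
    define X where "X = {u \<in> U. vec_coset W u \<in> Q}"
    have Q_eq: "Q = vec_coset W ` X"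
      using Q by (auto simp: quotient_invariant_subspace_def X_def)
    have "invariant_subspace S X"
      unfolding invariant_subspace_def vec.subspace_def
    proof (intro conjI ballI allI image_subsetI)
      show "0 \<in> X" using Q vec.subspace_0[OF subU] by (simp add: X_def quotient_invariant_subspace_def)
      show "u + v \<in> X" if "u \<in> X" "v \<in> X" for u v
        using Q that vec.subspace_add[OF subU] by (simp add: X_def quotient_invariant_subspace_def)
      show "c *s u \<in> X" if "u \<in> X" for c u
        using Q that vec.subspace_scale[OF subU] by (simp add: X_def quotient_invariant_subspace_def)
      show "u v* B \<in> X" if "B \<in> S" "u \<in> X" for B u
      proof -
        have "u v* B \<in> U" using U that unfolding invariant_subspace_def X_def by blast
        then show ?thesis using Q that by (simp add: X_def quotient_invariant_subspace_def)
      qed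
    qed
    moreover have "W \<subseteq> X"
    proof
      fix w assume "w \<in> W"
      then have "vec_coset W w = vec_coset W 0" by (simp add: vec_coset_eq_iff[OF subW])
      then show "w \<in> X" using \<open>w \<in> W\<close> WU Q by (auto simp: X_def quotient_invariant_subspace_def)
    qed
    moreover have "X \<subseteq> U" by (auto simp: X_def)
    ultimately consider "X = W" | "X = U" using cov by (auto simp: covers_def)
    then show "Q = {vec_coset W 0} \<or> Q = vec_coset W ` U"
    proof cases
      case 1
      have "vec_coset W w = vec_coset W 0" if "w \<in> W" for w
        using that by (simp add: vec_coset_eq_iff[OF subW])
      then have "Q = {vec_coset W 0}"
        using Q_eq 1 vec.subspace_0[OF subW] by blast
      then show ?thesis ..
    qed (use Q_eq in auto)
  qed
qed

section \<open>A covering step raises the measure by at most one\<close>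

lemma dim_le_Suc_if_subset_span:
  fixes U W :: "('a::field^'n::finite) set"
  assumes "U \<subseteq> vec.span (insert x W)"
  shows "vec.dim U \<le> Suc (vec.dim W)"
proof -
  have "vec.dim U \<le> vec.dim (insert x W)" using assms by (rule vec.dim_mono)
  also have "\<dots> \<le> Suc (vec.dim W)" by (simp add: vec.dim_insert)
  finally show ?thesis .
qed

text \<open>In either case an invariant \<open>X\<close> strictly above \<open>W\<close> is built
  inside \<open>U\<close>, and the covering property forces \<open>U = X\<close>. If no new
  coordinate vector appears, \<open>X\<close> is \<open>W\<close> plus any one vector; otherwise it
  is \<open>W\<close> plus the coordinate space of one component. Projecting to the representatives
  then leaves at most one new direction.\<close>

lemma covers_measure_le:
  fixes W U :: "('a::field^'n::finite) set"
  assumes W: "invariant_subspace (graph_matrix_space E) W"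
    and U: "invariant_subspace (graph_matrix_space E) U"
    and cov: "covers (graph_matrix_space E) U W"
  shows "vec.dim (U \<inter> coord_space (range (scc_rep E)))
    \<le> Suc (vec.dim (W \<inter> coord_space (range (scc_rep E))))"
proof -
  let ?T = "range (scc_rep E)"
  note subW = invariant_subspaceD[OF W] and subU = invariant_subspaceD[OF U]
  have WU: "W \<subset> U" using cov by (simp add: covers_def)
  have PW: "restrict_coords ?T w \<in> vec.span (insert x (W \<inter> coord_space ?T))" if "w \<in> W" for w x
    using restrict_coords_rep_in[OF W that] by (blast intro: vec.span_base)
  show ?thesis
  proof (cases "\<exists>j. axis j 1 \<in> U - W")
    case False
    obtain x where x: "x \<in> U" "x \<notin> W" using WU by blast
    define X where "X = vec.span (insert x W)"
    have X_eq: "X = {y. \<exists>k. y - k *s x \<in> W}"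
      unfolding X_def vec.span_insert vec.span_eq_iff[THEN iffD2, OF subW] ..
    have "X \<subseteq> U" unfolding X_def using x WU subU by (intro vec.span_minimal) auto
    \<comment> \<open>A nonzero image along an edge is a multiple of a coordinate vector of
      \<open>U\<close>; in this case such a vector already lies in \<open>W\<close>.\<close>
    have "axis j (u $ i) \<in> X" if "(i, j) \<in> E" "u \<in> X" for i j u
    proof (cases "u $ i = 0")
      case True
      then show ?thesis by (simp add: X_def vec.span_zero axis_zero)
    next
      case nz: False
      have "axis j 1 \<in> U" using invariant_edge[OF U _ nz that(1)] that \<open>X \<subseteq> U\<close> by blast
      then have "axis j 1 \<in> W" using False by blast
      then have "u $ i *s axis j 1 \<in> W" by (rule vec.subspace_scale[OF subW])
      then show ?thesis by (auto simp: X_def scale_axis intro: vec.span_base)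
    qed
    then have "invariant_subspace (graph_matrix_space E) X"
      unfolding invariant_subspace_graph_iff by (auto simp: X_def)
    moreover have "W \<subseteq> X" "x \<in> X" by (auto simp: X_def intro: vec.span_base)
    ultimately have "U = X" using cov \<open>X \<subseteq> U\<close> x by (auto simp: covers_def)
    \<comment> \<open>The projection fixes \<open>u\<close>, sends the \<open>W\<close>-part into
      \<open>W \<inter> coord_space ?T\<close> and turns \<open>x\<close> into the single extra
      generator.\<close>
    have "U \<inter> coord_space ?T \<subseteq> vec.span (insert (restrict_coords ?T x) (W \<inter> coord_space ?T))"
    proof
      fix u assume u: "u \<in> U \<inter> coord_space ?T"
      then obtain k where k: "u - k *s x \<in> W" using \<open>U = X\<close> X_eq by blast
      have "u = restrict_coords ?T (k *s x + (u - k *s x))"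
        using u by (simp add: restrict_coords_id)
      also have "\<dots> = k *s restrict_coords ?T x + restrict_coords ?T (u - k *s x)"
        by (simp only: restrict_coords_add restrict_coords_scale)
      also have "\<dots> \<in> vec.span (insert (restrict_coords ?T x) (W \<inter> coord_space ?T))"
        by (intro vec.span_add[OF _ PW[OF k]] vec.span_scale vec.span_base) simp
      finally show "u \<in> vec.span (insert (restrict_coords ?T x) (W \<inter> coord_space ?T))" .
    qed
    then show ?thesis by (rule dim_le_Suc_if_subset_span)
  next
    case True
    \<comment> \<open>With a reachable set of minimal size, everything outside \<open>W\<close> reachable from \<open>j\<close> reaches
      back to \<open>j\<close>.\<close>
    define j where "j = arg_min (\<lambda>j. card (E\<^sup>* `` {j})) (\<lambda>j. axis j 1 \<in> U - W)"
    have j: "axis j 1 \<in> U - W"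
      unfolding j_def using True by (metis (no_types, lifting) arg_min_natI)
    have card_min: "card (E\<^sup>* `` {j}) \<le> card (E\<^sup>* `` {k})" if "axis k 1 \<in> U - W" for k
      unfolding j_def using that by (rule arg_min_nat_le)
    define C where "C = scc_class E j"
    have returns: "k \<in> C \<or> axis k 1 \<in> W" if jk: "(j, k) \<in> E\<^sup>*" for k
    proof (rule disjCI)
      assume "axis k 1 \<notin> W"
      moreover have "axis k 1 \<in> U" using invariant_rtrancl[OF U _ jk] j by blast
      ultimately have "card (E\<^sup>* `` {j}) \<le> card (E\<^sup>* `` {k})" by (intro card_min) blast
      moreover have "E\<^sup>* `` {k} \<subseteq> E\<^sup>* `` {j}" using jk by (auto intro: rtrancl_trans)
      \<comment> \<open>One reachable set contains the other and is no larger, so they coincide; in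
        particular \<open>k\<close> reaches \<open>j\<close>.\<close>
      ultimately have "E\<^sup>* `` {k} = E\<^sup>* `` {j}" by (intro card_seteq) auto
      then show "k \<in> C" using jk by (auto simp: C_def scc_class_def)
    qed
    have CU: "coord_space C \<subseteq> U"
    proof (rule coord_space_subset[OF subU])
      fix k assume "k \<in> C"
      then show "axis k 1 \<in> U"
        using invariant_rtrancl[OF U, of j k] j by (auto simp: C_def scc_class_def)
    qed
    define X where "X = {w + c |w c. w \<in> W \<and> c \<in> coord_space C}"
    have subX: "vec.subspace X"
      unfolding X_def by (rule vec.subspace_sums[OF subW subspace_coord_space])
    have WX: "W \<subseteq> X"
      using vec.subspace_0[OF subspace_coord_space, of C] by (force simp: X_def)
    have CX: "coord_space C \<subseteq> X"
      using vec.subspace_0[OF subW] by (force simp: X_def)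
    \<comment> \<open>The summand in \<open>W\<close> is handled by invariance of \<open>W\<close>.
      For the other one, an edge starting in \<open>C\<close> ends in \<open>C\<close> or at a
      vertex whose coordinate vector is in \<open>W\<close>, by \<open>returns\<close>.\<close>
    have "axis b (u $ a) \<in> X" if ab: "(a, b) \<in> E" and "u \<in> X" for a b u
    proof -
      obtain w c where wc: "u = w + c" "w \<in> W" "c \<in> coord_space C"
        using \<open>u \<in> X\<close> by (auto simp: X_def)
      have w: "axis b (w $ a) \<in> X"
        using invariant_axis[OF W ab wc(2)] WX by blast
      have "axis b (c $ a) \<in> X"
      proof (cases "c $ a = 0")
        case True
        then show ?thesis
          using vec.subspace_0[OF subX] by (simp add: axis_zero)
      next
        case False
        then have "(j, a) \<in> E\<^sup>*" using wc(3) by (auto simp: coord_space_def C_def scc_class_def)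
        then have "b \<in> C \<or> axis b 1 \<in> W" using ab by (intro returns) auto
        then have "axis b 1 \<in> X"
          using WX CX axis_in_coord_space by blast
        then have "c $ a *s axis b 1 \<in> X" by (rule vec.subspace_scale[OF subX])
        then show ?thesis by (simp only: scale_axis)
      qed
      then have "axis b (w $ a) + axis b (c $ a) \<in> X" by (rule vec.subspace_add[OF subX w])
      also have "axis b (w $ a) + axis b (c $ a) = axis b (u $ a)"
        by (simp add: wc(1) vec_eq_iff axis_def)
      finally show ?thesis .
    qed
    then have "invariant_subspace (graph_matrix_space E) X"
      unfolding invariant_subspace_graph_iff using subX by auto
    moreover have "X \<subseteq> U"
    proof
      fix x assume "x \<in> X"
      then obtain w c where "x = w + c" "w \<in> U" "c \<in> U" using WU CU unfolding X_def by blast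
      then show "x \<in> U" by (simp add: vec.subspace_add[OF subU])
    qed
    moreover have "axis j 1 \<in> X"
      using CX axis_in_coord_space[of j C] by (auto simp: C_def scc_class_def)
    ultimately have "U = X" using cov WX j by (auto simp: covers_def)
    let ?r = "axis (scc_rep E j) 1 :: 'a^'n"
    have "U \<inter> coord_space ?T \<subseteq> vec.span (insert ?r (W \<inter> coord_space ?T))"
    proof
      fix u assume u: "u \<in> U \<inter> coord_space ?T"
      then obtain w c where wc: "u = w + c" "w \<in> W" "c \<in> coord_space C"
        using \<open>U = X\<close> by (auto simp: X_def)
      \<comment> \<open>The component \<open>C\<close> contains just one representative, so
        projecting a vector of \<open>coord_space C\<close> leaves a multiple of
        \<open>?r\<close>.\<close>
      have "i = scc_rep E j" if "i \<in> ?T" "i \<in> C" for i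
        using that scc_rep_idem[of E] scc_rep_eq[of i E j] by (auto simp: C_def)
      then have "i \<in> ?T \<and> c $ i \<noteq> 0 \<longrightarrow> i = scc_rep E j" for i
        using wc(3) unfolding coord_space_def by blast
      then have "restrict_coords ?T c $ i = (c $ scc_rep E j *s ?r) $ i" for i
        by (cases "i = scc_rep E j") (auto simp: restrict_coords_def axis_def)
      then have "restrict_coords ?T c = c $ scc_rep E j *s ?r" by (simp only: vec_eq_iff) blast
      moreover have "u = restrict_coords ?T w + restrict_coords ?T c"
        using u wc(1) by (simp add: restrict_coords_id flip: restrict_coords_add)
      ultimately have "u = c $ scc_rep E j *s ?r + restrict_coords ?T w" by simp
      also have "\<dots> \<in> vec.span (insert ?r (W \<inter> coord_space ?T))"
        by (intro vec.span_add[OF _ PW[OF wc(2)]] vec.span_scale vec.span_base) simp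
      finally show "u \<in> vec.span (insert ?r (W \<inter> coord_space ?T))" .
    qed
    then show ?thesis by (rule dim_le_Suc_if_subset_span)
  qed
qed

section \<open>Length and existence of maximal chains\<close>

lemma maximal_chain_length:
  fixes U :: "nat \<Rightarrow> ('a::field^'n::finite) set"
  assumes "maximal_invariant_chain (graph_matrix_space E) k U"
  shows "k = card (range (scc_rep E))"
proof -
  let ?T = "range (scc_rep E)"
  have inv: "invariant_subspace (graph_matrix_space E) (U i)" if "i \<le> k" for i
    using assms that by (simp add: maximal_invariant_chain_def)
  \<comment> \<open>Strict monotonicity gives an increase of at least one at each step, and the
    covering bound gives at most one. At \<open>i = k\<close> the subspace is \<open>UNIV\<close>,
    whose measure is \<open>card ?T\<close>.\<close>
  have "vec.dim (U i \<inter> coord_space ?T) = i" if "i \<le> k" for i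
    using that
  proof (induction i)
    case 0
    have "U 0 \<inter> coord_space ?T = {0}"
      using assms by (auto simp: maximal_invariant_chain_def coord_space_def)
    then show ?case by simp
  next
    case (Suc i)
    have "U i \<subset> U (Suc i)" "irreducible_on_quotient (graph_matrix_space E) (U (Suc i)) (U i)"
      using assms Suc.prems by (auto simp: maximal_invariant_chain_def)
    moreover have i: "invariant_subspace (graph_matrix_space E) (U i)"
      "invariant_subspace (graph_matrix_space E) (U (Suc i))"
      using Suc.prems by (auto intro: inv)
    ultimately have "covers (graph_matrix_space E) (U (Suc i)) (U i)"
      by (simp add: irreducible_on_quotient_iff_covers)
    then show ?case
      using covers_measure_le[OF i] invariant_measure_strict_mono[OF i \<open>U i \<subset> U (Suc i)\<close>]
        Suc by simp
  qed
  from this[of k] show ?thesis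
    using assms by (simp add: maximal_invariant_chain_def dim_coord_space)
qed

text \<open>A proper invariant subspace of \<open>U\<close> of greatest dimension is covered by
  \<open>U\<close>; a chain up to it exists by induction on the dimension. The definite description
  in \<open>chain_length\<close> needs this existence besides uniqueness.\<close>

lemma ex_maximal_chain_to:
  fixes U :: "('a::field^'n::finite) set"
  assumes "invariant_subspace S U"
  shows "\<exists>k V. V 0 = {0} \<and> V k = U \<and> (\<forall>i\<le>k. invariant_subspace S (V i)) \<and>
     (\<forall>i<k. V i \<subset> V (Suc i) \<and> irreducible_on_quotient S (V (Suc i)) (V i))"
  using assms
proof (induction "vec.dim U" arbitrary: U rule: less_induct)
  case less
  note U = less.prems
  note subU = invariant_subspaceD[OF U]
  have dim_less: "vec.dim A < vec.dim B" if "invariant_subspace S A" "invariant_subspace S B" "A \<subset> B"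
    for A B
    by (rule dim_less_if_psubset[OF invariant_subspaceD[OF that(1)] invariant_subspaceD[OF that(2)] that(3)])
  have zero: "invariant_subspace S {0}"
    by (simp add: invariant_subspace_def vector_matrix_mult_0)
  show ?case
  proof (cases "U = {0}")
    case True
    then show ?thesis using zero by (intro exI[of _ 0] exI[of _ "\<lambda>_. {0}"]) auto
  next
    case False
    define P where "P = (\<lambda>W. invariant_subspace S W \<and> W \<subset> U)"
    have "P {0}" using False zero vec.subspace_0[OF subU] by (auto simp: P_def)
    moreover have "\<forall>W. P W \<longrightarrow> vec.dim W < Suc (vec.dim U)"
      using dim_less U by (auto simp: P_def intro: less_SucI)
    ultimately obtain W where W: "P W" and max: "\<And>X. P X \<Longrightarrow> vec.dim X \<le> vec.dim W"
      using ex_has_greatest_nat[of P "{0}" vec.dim "Suc (vec.dim U)"] by auto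
    have invW: "invariant_subspace S W" and WU: "W \<subset> U" using W by (auto simp: P_def)
    have "X = W \<or> X = U" if "invariant_subspace S X" "W \<subseteq> X" "X \<subseteq> U" for X
      using that max[of X] dim_less[OF invW that(1)] by (fastforce simp: P_def)
    then have "covers S U W" using WU by (auto simp: covers_def)
    then have irr: "irreducible_on_quotient S U W"
      using irreducible_on_quotient_iff_covers[OF invW U WU] by simp
    obtain k V where V: "V 0 = {0}" "V k = W" "\<forall>i\<le>k. invariant_subspace S (V i)"
      "\<forall>i<k. V i \<subset> V (Suc i) \<and> irreducible_on_quotient S (V (Suc i)) (V i)"
      using less.hyps[OF dim_less[OF invW U WU] invW] by blast
    show ?thesis
      using V irr WU U
      \<comment> \<open>The chain ending in \<open>W\<close> at index \<open>k\<close> is prolonged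
        by \<open>U\<close> at index \<open>Suc k\<close>.\<close>
      by (intro exI[of _ "Suc k"] exI[of _ "V(Suc k := U)"]) (auto simp: less_Suc_eq le_Suc_eq)
  qed
qed

lemma invariant_UNIV: "invariant_subspace S UNIV"
  by (simp add: invariant_subspace_def)

lemma chain_length_graph:
  "chain_length (graph_matrix_space E :: ('a::field^'n^'n) set) = card (range (scc_rep E))"
  unfolding chain_length_def
proof (rule the_equality)
  \<comment> \<open>Some chain exists, and its length, unknown at first, must be the number of
    representatives.\<close>
  obtain k and V :: "nat \<Rightarrow> ('a^'n) set"
    where "maximal_invariant_chain (graph_matrix_space E) k V"
    using ex_maximal_chain_to[OF invariant_UNIV[of "graph_matrix_space E"]]
    by (auto simp: maximal_invariant_chain_def)
  then show "\<exists>U. maximal_invariant_chain (graph_matrix_space E :: ('a^'n^'n) set)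
      (card (range (scc_rep E))) U"
    using maximal_chain_length by blast
qed (use maximal_chain_length in blast)

section \<open>Irreducibility and strong connectivity\<close>

lemma irreducible_graph_iff:
  "irreducible_matrix_space (graph_matrix_space E :: ('a::field^'n^'n) set) \<longleftrightarrow>
    (\<forall>u v. (u, v) \<in> E\<^sup>*)"
proof
  assume irr: "irreducible_matrix_space (graph_matrix_space E :: ('a^'n^'n) set)"
  show "\<forall>u v. (u, v) \<in> E\<^sup>*"
  proof (intro allI)
    fix u v
    \<comment> \<open>The set of vertices reachable from \<open>u\<close> is closed under edges, so
      its coordinate space is invariant. It is nonzero because \<open>u\<close> reaches
      itself.\<close>
    let ?U = "coord_space (E\<^sup>* `` {u}) :: ('a^'n) set"
    have "invariant_subspace (graph_matrix_space E) ?U"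
      unfolding invariant_subspace_graph_iff
      by (auto simp: subspace_coord_space) (auto simp: coord_space_def axis_def intro: rtrancl_into_rtrancl)
    then have "?U = {0} \<or> ?U = UNIV" using irr by (simp add: irreducible_matrix_space_def)
    moreover have "axis u 1 \<in> ?U" "axis u 1 \<noteq> (0 :: 'a^'n)"
      by (auto simp: coord_space_def axis_def vec_eq_iff)
    ultimately have "axis v 1 \<in> ?U" by blast
    then show "(u, v) \<in> E\<^sup>*" by (auto simp: coord_space_def axis_def)
  qed
next
  assume conn: "\<forall>u v. (u, v) \<in> E\<^sup>*"
  \<comment> \<open>Here \<open>undefined\<close> is merely some vertex: all vertices share one
    class and hence one representative.\<close>
  then have "range (scc_rep E) = {scc_rep E undefined}"
    using scc_rep_eq[of _ E undefined] by (auto simp: scc_class_def)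
  then have one: "vec.dim (coord_space (range (scc_rep E)) :: ('a^'n) set) = 1"
    by (simp add: dim_coord_space)
  have "U = {0} \<or> U = UNIV" if U: "invariant_subspace (graph_matrix_space E) U"
    for U :: "('a^'n) set"
  proof (rule ccontr)
    assume nontriv: "\<not> (U = {0} \<or> U = UNIV)"
    have zero: "invariant_subspace (graph_matrix_space E) ({0} :: ('a^'n) set)"
      by (simp add: invariant_subspace_def vector_matrix_mult_0)
    have "{0} \<subset> U" using nontriv vec.subspace_0[OF invariant_subspaceD[OF U]] by blast
    have "U \<subset> UNIV" using nontriv by blast
    \<comment> \<open>Two strict increases, from \<open>{0}\<close> to \<open>U\<close> and from
      \<open>U\<close> to \<open>UNIV\<close>, would need a final measure of at least two, but it is
      one.\<close>
    show False
      using invariant_measure_strict_mono[OF zero U \<open>{0} \<subset> U\<close>]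
        invariant_measure_strict_mono[OF U invariant_UNIV \<open>U \<subset> UNIV\<close>] one
      unfolding Int_UNIV_left by linarith
  qed
  then show "irreducible_matrix_space (graph_matrix_space E :: ('a^'n^'n) set)"
    by (simp add: irreducible_matrix_space_def)
qed

theorem theorem5p1:
  fixes E :: "('n::finite \<times> 'n) set"
  shows "num_sccs (digraph_of E) =
           chain_length (graph_matrix_space E :: ('a::field^'n^'n) set) \<and>
         (strongly_connected (digraph_of E) \<longleftrightarrow>
           irreducible_matrix_space (graph_matrix_space E :: ('a::field^'n^'n) set))"
  by (simp add: num_sccs_digraph_of chain_length_graph strongly_connected_digraph_of
      irreducible_graph_iff)

end
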